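(* Let $(A,\mathfrak m)$ be a local Noetherian unique factorization domain that is not a field. Let $\operatorname{X}^1(A)$ be the set of prime ideals of $A$ of height one, and put \[ M_A=\bigoplus_{\mathfrak p\in\operatorname{X}^1(A)}(A/\mathfrak p)^{(\mathbb N)}, \qquad T_A=A\ltimes M_A. \] Then $T_A$ has no nonzero proper finitely presented ideals.
   Context: All rings are commutative with identity and all modules are unital. For an $A$-module $N$, $N^{(\mathbb N)}$ denotes the direct sum of countably infinitely many copies of $N$ (indexed by $\mathbb N$). For a ring $D$ and a $D$-module $E$, the idealization $D\ltimes E$ is the abelian group $D\oplus E$ with multiplication $(a,e)(b,f)=(ab,af+be)$. An ideal is finitely presented if it is finitely presented as a module over the ring. *)

theory Defs
  imports
    "HOL-Algebra.Ring_Divisibility"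
    "HOL-Algebra.Module"
    "HOL-Algebra.Product_Groups"
    "HOL-Library.Extended_Nat"
begin

locale local_ring = maximalideal \<mm> R + cring R for \<mm> and R (structure) +
  assumes maximalideal_unique: "maximalideal \<nn> R \<Longrightarrow> \<nn> = \<mm>"

text \<open>The supremum of the lengths of chains of prime ideals ending in \<^term>\<open>P\<close>.\<close>

definition height :: "('a, 'b) ring_scheme \<Rightarrow> 'a set \<Rightarrow> enat" where
  "height R P = Sup {enat n | n. \<exists>Q :: nat \<Rightarrow> 'a set.
     (\<forall>i\<le>n. primeideal (Q i) R) \<and> (\<forall>i<n. Q i \<subset> Q (Suc i)) \<and> Q n = P}"

definition height_one_primes :: "('a, 'b) ring_scheme \<Rightarrow> 'a set set" where
  "height_one_primes R = {P. primeideal P R \<and> height R P = 1}"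

text \<open>
  The record type \<^typ>\<open>('a, 'b) module\<close> extends the one of rings, but the locale
  \<^locale>\<open>module\<close> ignores the fields \<^const>\<open>mult\<close> and \<^const>\<open>one\<close>; their values below
  are irrelevant.
\<close>

definition ideal_module :: "('a, 'b) ring_scheme \<Rightarrow> 'a set \<Rightarrow> ('a, 'a) module" where
  "ideal_module R I =
    \<lparr>carrier = I, mult = mult R, one = one R, zero = zero R, add = add R, smult = mult R\<rparr>"

definition quotient_module :: "('a, 'b) ring_scheme \<Rightarrow> 'a set \<Rightarrow> ('a, 'a set) module" where
  "quotient_module R I =
    \<lparr>carrier = carrier (R Quot I), mult = mult (R Quot I), one = one (R Quot I),
     zero = zero (R Quot I), add = add (R Quot I),
     smult = (\<lambda>a X. (I +>\<^bsub>R\<^esub> a) \<otimes>\<^bsub>R Quot I\<^esub> X)\<rparr>"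

text \<open>
  The underlying group is the library's restricted product \<^const>\<open>sum_group\<close> of the additive
  groups; see \<open>carrier_direct_sum\<close> below for its elements.
\<close>

definition direct_sum :: "'i set \<Rightarrow> ('i \<Rightarrow> ('a, 'b) module) \<Rightarrow> ('a, 'i \<Rightarrow> 'b) module" where
  "direct_sum I N =
    \<lparr>carrier = carrier (sum_group I (\<lambda>i. add_monoid (N i))), mult = undefined, one = undefined,
     zero = one (sum_group I (\<lambda>i. add_monoid (N i))),
     add = mult (sum_group I (\<lambda>i. add_monoid (N i))),
     smult = (\<lambda>a x. \<lambda>i\<in>I. a \<odot>\<^bsub>N i\<^esub> x i)\<rparr>"

definition countable_power :: "('a, 'b) module \<Rightarrow> ('a, nat \<Rightarrow> 'b) module" where
  "countable_power N = direct_sum UNIV (\<lambda>_. N)"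

definition free_module :: "('a, 'b) ring_scheme \<Rightarrow> nat \<Rightarrow> ('a, nat \<Rightarrow> 'a) module" where
  "free_module R n = direct_sum {..<n} (\<lambda>_. ideal_module R (carrier R))"

definition module_hom ::
  "('a, 'm) ring_scheme \<Rightarrow> ('a, 'b) module \<Rightarrow> ('a, 'c) module \<Rightarrow> ('b \<Rightarrow> 'c) set" where
  "module_hom R M N = {h \<in> carrier M \<rightarrow> carrier N.
     (\<forall>x\<in>carrier M. \<forall>y\<in>carrier M. h (x \<oplus>\<^bsub>M\<^esub> y) = h x \<oplus>\<^bsub>N\<^esub> h y) \<and>
     (\<forall>a\<in>carrier R. \<forall>x\<in>carrier M. h (a \<odot>\<^bsub>M\<^esub> x) = a \<odot>\<^bsub>N\<^esub> h x)}"

definition module_span :: "('a, 'm) ring_scheme \<Rightarrow> ('a, 'b) module \<Rightarrow> 'b set \<Rightarrow> 'b set" where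
  "module_span R M S = \<Inter>{H. submodule H R M \<and> S \<subseteq> H}"

definition finitely_generated_submodule ::
  "('a, 'm) ring_scheme \<Rightarrow> ('a, 'b) module \<Rightarrow> 'b set \<Rightarrow> bool" where
  "finitely_generated_submodule R M K \<longleftrightarrow>
     (\<exists>S. finite S \<and> S \<subseteq> carrier M \<and> K = module_span R M S)"

text \<open>There is an exact sequence \<open>R\<^sup>m \<rightarrow> R\<^sup>n \<rightarrow> M \<rightarrow> 0\<close>.\<close>

definition finitely_presented :: "('a, 'm) ring_scheme \<Rightarrow> ('a, 'b) module \<Rightarrow> bool" where
  "finitely_presented R M \<longleftrightarrow>
     (\<exists>n. \<exists>h\<in>module_hom R (free_module R n) M.
        h ` carrier (free_module R n) = carrier M \<and>
        finitely_generated_submodule R (free_module R n) (a_kernel (free_module R n) M h))"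

definition idealization ::
  "('a, 'm) ring_scheme \<Rightarrow> ('a, 'b) module \<Rightarrow> ('a \<times> 'b) ring" (infixl \<open>\<ltimes>\<close> 65) where
  "D \<ltimes> E =
    \<lparr>carrier = carrier D \<times> carrier E,
     mult = (\<lambda>(a, e) (b, f). (a \<otimes>\<^bsub>D\<^esub> b, (a \<odot>\<^bsub>E\<^esub> f) \<oplus>\<^bsub>E\<^esub> (b \<odot>\<^bsub>E\<^esub> e))),
     one = (\<one>\<^bsub>D\<^esub>, \<zero>\<^bsub>E\<^esub>),
     zero = (\<zero>\<^bsub>D\<^esub>, \<zero>\<^bsub>E\<^esub>),
     add = (\<lambda>(a, e) (b, f). (a \<oplus>\<^bsub>D\<^esub> b, e \<oplus>\<^bsub>E\<^esub> f))\<rparr>"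

definition M_of :: "('a, 'm) ring_scheme \<Rightarrow> ('a, 'a set \<Rightarrow> nat \<Rightarrow> 'a set) module" where
  "M_of A = direct_sum (height_one_primes A) (\<lambda>\<pp>. countable_power (quotient_module A \<pp>))"

definition T_of :: "('a, 'm) ring_scheme \<Rightarrow> ('a \<times> ('a set \<Rightarrow> nat \<Rightarrow> 'a set)) ring" where
  "T_of A = A \<ltimes> M_of A"

lemma module_ideal_module:
  fixes R (structure)
  assumes "cring R" "ideal I R"
  shows "module R (ideal_module R I)"
proof -
  interpret cring R by fact
  interpret I: ideal I R by fact
  note sub = I.a_subset[THEN subsetD]
  show ?thesis
  proof (rule moduleI)
    show "abelian_group (ideal_module R I)"
    proof (rule abelian_groupI)
      show "\<exists>y\<in>carrier (ideal_module R I). y \<oplus>\<^bsub>ideal_module R I\<^esub> x = \<zero>\<^bsub>ideal_module R I\<^esub>"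
        if "x \<in> carrier (ideal_module R I)" for x
        using that sub[of x] by (auto simp: ideal_module_def intro!: bexI[of _ "\<ominus> x"] l_neg)
    qed (auto simp: ideal_module_def a_ac sub)
  qed (auto simp: ideal_module_def sub I.I_l_closed l_distr r_distr m_assoc \<open>cring R\<close>)
qed

lemma module_quotient_module:
  fixes R (structure)
  assumes "cring R" "ideal I R"
  shows "module R (quotient_module R I)"
proof -
  interpret cring R by fact
  interpret I: ideal I R by fact
  interpret Q: cring "R Quot I" by (rule I.quotient_is_cring[OF \<open>cring R\<close>])
  interpret h: ring_hom_ring R "R Quot I" "(+>) I" by (rule I.rcos_ring_hom_ring)
  show ?thesis
  proof (rule moduleI)
    show "abelian_group (quotient_module R I)"
    proof (rule abelian_groupI)
      show "\<exists>y\<in>carrier (quotient_module R I). y \<oplus>\<^bsub>quotient_module R I\<^esub> x = \<zero>\<^bsub>quotient_module R I\<^esub>"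
        if "x \<in> carrier (quotient_module R I)" for x
        using that by (auto simp: quotient_module_def intro!: bexI[of _ "\<ominus>\<^bsub>R Quot I\<^esub> x"] Q.l_neg)
    qed (auto simp: quotient_module_def Q.a_ac)
  qed (auto simp: quotient_module_def Q.l_distr Q.r_distr Q.m_assoc \<open>cring R\<close>)
qed

lemma carrier_direct_sum:
  assumes "\<And>i. i \<in> I \<Longrightarrow> module R (N i)"
  shows "carrier (direct_sum I N) =
    {x \<in> \<Pi>\<^sub>E i\<in>I. carrier (N i). finite {i \<in> I. x i \<noteq> \<zero>\<^bsub>N i\<^esub>}}"
  using carrier_sum_group[of I "\<lambda>i. add_monoid (N i)"] assms
  by (simp add: direct_sum_def module_def abelian_group.a_group)

lemma zero_direct_sum: "\<zero>\<^bsub>direct_sum I N\<^esub> = (\<lambda>i\<in>I. \<zero>\<^bsub>N i\<^esub>)"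
  by (simp add: direct_sum_def sum_group_def)

lemma add_direct_sum: "x \<oplus>\<^bsub>direct_sum I N\<^esub> y = (\<lambda>i\<in>I. x i \<oplus>\<^bsub>N i\<^esub> y i)"
  by (simp add: direct_sum_def sum_group_def)

lemma smult_direct_sum: "a \<odot>\<^bsub>direct_sum I N\<^esub> x = (\<lambda>i\<in>I. a \<odot>\<^bsub>N i\<^esub> x i)"
  by (simp add: direct_sum_def)

lemma module_direct_sum:
  assumes R: "cring R" and N: "\<And>i. i \<in> I \<Longrightarrow> module R (N i)"
  shows "module R (direct_sum I N)"
proof -
  note sums = zero_direct_sum add_direct_sum smult_direct_sum
  interpret R: cring R by (rule R)
  have ab: "abelian_group (N i)" if "i \<in> I" for i
    using N[OF that] by (simp add: module_def)
  interpret G: group "sum_group I (\<lambda>i. add_monoid (N i))"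
    using ab by (intro sum_group abelian_group.a_group)
  have mem: "x i \<in> carrier (N i)" if "x \<in> carrier (direct_sum I N)" "i \<in> I" for x i
    using that carrier_direct_sum[OF N, of I] by auto
  have ext: "x = (\<lambda>i\<in>I. x i)" if "x \<in> carrier (direct_sum I N)" for x
    using that by (auto simp: carrier_direct_sum[OF N])
  have closed: "a \<odot>\<^bsub>direct_sum I N\<^esub> x \<in> carrier (direct_sum I N)"
    if a: "a \<in> carrier R" and x: "x \<in> carrier (direct_sum I N)" for a x
  proof -
    have "{i \<in> I. (a \<odot>\<^bsub>direct_sum I N\<^esub> x) i \<noteq> \<zero>\<^bsub>N i\<^esub>} \<subseteq> {i \<in> I. x i \<noteq> \<zero>\<^bsub>N i\<^esub>}"
      using module.smult_r_null[OF N a] by (auto simp: sums)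
    moreover have "finite {i \<in> I. x i \<noteq> \<zero>\<^bsub>N i\<^esub>}"
      using x by (simp add: carrier_direct_sum[OF N])
    ultimately have "finite {i \<in> I. (a \<odot>\<^bsub>direct_sum I N\<^esub> x) i \<noteq> \<zero>\<^bsub>N i\<^esub>}"
      by (rule finite_subset)
    moreover have "a \<odot>\<^bsub>direct_sum I N\<^esub> x \<in> (\<Pi>\<^sub>E i\<in>I. carrier (N i))"
      using module.smult_closed[OF N a] mem[OF x] by (auto simp: sums)
    ultimately show ?thesis by (simp add: carrier_direct_sum[OF N])
  qed
  have abel: "abelian_group (direct_sum I N)"
  proof (rule abelian_groupI)
    fix x y z
    assume x: "x \<in> carrier (direct_sum I N)" and y: "y \<in> carrier (direct_sum I N)"
      and z: "z \<in> carrier (direct_sum I N)"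
    show "x \<oplus>\<^bsub>direct_sum I N\<^esub> y \<in> carrier (direct_sum I N)"
      using G.m_closed x y by (simp add: direct_sum_def)
    show "x \<oplus>\<^bsub>direct_sum I N\<^esub> y \<oplus>\<^bsub>direct_sum I N\<^esub> z =
        x \<oplus>\<^bsub>direct_sum I N\<^esub> (y \<oplus>\<^bsub>direct_sum I N\<^esub> z)"
      using G.m_assoc x y z by (simp add: direct_sum_def)
    show "x \<oplus>\<^bsub>direct_sum I N\<^esub> y = y \<oplus>\<^bsub>direct_sum I N\<^esub> x"
      using mem[OF x] mem[OF y] abelian_monoid.a_comm[OF abelian_group.axioms(1)[OF ab]]
      by (auto simp: sums restrict_def fun_eq_iff)
  next
    fix x assume x: "x \<in> carrier (direct_sum I N)"
    show "\<zero>\<^bsub>direct_sum I N\<^esub> \<oplus>\<^bsub>direct_sum I N\<^esub> x = x"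
      using G.l_one x by (simp add: direct_sum_def)
    show "\<exists>y\<in>carrier (direct_sum I N). y \<oplus>\<^bsub>direct_sum I N\<^esub> x = \<zero>\<^bsub>direct_sum I N\<^esub>"
      using G.l_inv_ex x by (simp add: direct_sum_def)
  next
    show "\<zero>\<^bsub>direct_sum I N\<^esub> \<in> carrier (direct_sum I N)"
      using G.one_closed by (simp add: direct_sum_def)
  qed
  show ?thesis
  proof (rule moduleI)
    fix a b x
    assume a: "a \<in> carrier R" and b: "b \<in> carrier R" and x: "x \<in> carrier (direct_sum I N)"
    show "(a \<oplus>\<^bsub>R\<^esub> b) \<odot>\<^bsub>direct_sum I N\<^esub> x =
        a \<odot>\<^bsub>direct_sum I N\<^esub> x \<oplus>\<^bsub>direct_sum I N\<^esub> b \<odot>\<^bsub>direct_sum I N\<^esub> x"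
      using module.smult_l_distr[OF N a b mem[OF x]]
      by (auto simp: sums restrict_def fun_eq_iff)
    show "(a \<otimes>\<^bsub>R\<^esub> b) \<odot>\<^bsub>direct_sum I N\<^esub> x =
        a \<odot>\<^bsub>direct_sum I N\<^esub> (b \<odot>\<^bsub>direct_sum I N\<^esub> x)"
      using module.smult_assoc1[OF N a b mem[OF x]]
      by (auto simp: sums restrict_def fun_eq_iff)
  next
    fix a x y
    assume a: "a \<in> carrier R" and x: "x \<in> carrier (direct_sum I N)"
      and y: "y \<in> carrier (direct_sum I N)"
    show "a \<odot>\<^bsub>direct_sum I N\<^esub> (x \<oplus>\<^bsub>direct_sum I N\<^esub> y) =
        a \<odot>\<^bsub>direct_sum I N\<^esub> x \<oplus>\<^bsub>direct_sum I N\<^esub> a \<odot>\<^bsub>direct_sum I N\<^esub> y"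
      using module.smult_r_distr[OF N a mem[OF x] mem[OF y]]
      by (auto simp: sums restrict_def fun_eq_iff)
  next
    fix x assume x: "x \<in> carrier (direct_sum I N)"
    show "\<one>\<^bsub>R\<^esub> \<odot>\<^bsub>direct_sum I N\<^esub> x = x"
      using module.smult_one[OF N mem[OF x]]
      by (subst (2) ext[OF x]) (auto simp: sums restrict_def fun_eq_iff)
  qed (use R abel closed in auto)
qed

lemma cring_idealization:
  assumes "module D E"
  shows "cring (D \<ltimes> E)"
proof -
  interpret module D E by fact
  show ?thesis
  proof (rule cringI)
    show "abelian_group (D \<ltimes> E)"
    proof (rule abelian_groupI)
      show "\<exists>y\<in>carrier (D \<ltimes> E). y \<oplus>\<^bsub>D \<ltimes> E\<^esub> x = \<zero>\<^bsub>D \<ltimes> E\<^esub>"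
        if "x \<in> carrier (D \<ltimes> E)" for x
        using that
        by (auto simp: idealization_def R.l_neg M.l_neg
            intro!: bexI[of _ "(\<ominus>\<^bsub>D\<^esub> fst x, \<ominus>\<^bsub>E\<^esub> snd x)"])
    qed (auto simp: idealization_def R.a_ac M.a_ac)
    show "comm_monoid (D \<ltimes> E)"
      by (rule comm_monoidI)
        (auto simp: idealization_def R.m_ac M.a_ac smult_r_distr
          smult_assoc1[symmetric])
  qed (auto simp: idealization_def R.l_distr smult_l_distr smult_r_distr M.a_ac)
qed

lemma module_M_of:
  assumes "cring A"
  shows "module A (M_of A)"
  unfolding M_of_def countable_power_def height_one_primes_def
  by (intro module_direct_sum module_quotient_module assms) (auto dest: primeideal.axioms(1))

lemma cring_T_of: "cring A \<Longrightarrow> cring (T_of A)"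
  unfolding T_of_def by (intro cring_idealization module_M_of)

lemma module_free_module:
  assumes "cring R"
  shows "module R (free_module R n)"
  unfolding free_module_def
  by (intro module_direct_sum module_ideal_module assms ring.oneideal cring.axioms(1)[OF assms])

end

theory Submission
  imports Defs "HOL-Algebra.Ideal_Product"
begin

text \<open>
  Write \<open>T = A \<ltimes> M\<close>, let \<open>I\<close> be a finitely presented ideal of \<open>T\<close>, and let \<open>J\<close> be its image
  in \<open>A\<close>.  The summand \<open>A/\<pp>\<close> occurs in \<open>M\<close> infinitely often, whereas finitely many relations
  between the generators of \<open>I\<close> have nonzero entries in finitely many copies only.  So for every
  \<open>\<pp>\<close> there is a copy of \<open>A/\<pp>\<close> that the generating relations do not meet.  Multiplication by
  its generator \<open>e\<close>, which is annihilated by \<open>\<pp>\<close>, turns the coefficients of any element of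
  \<open>I \<inter> (\<pp> \<times> M)\<close> into a relation that lives in this copy, and reading off how that relation
  is generated shows that, modulo \<open>\<pp>\<close>, those coefficients agree with the ones of a relation
  over \<open>T\<close>.  Subtracting the latter gives
  \<open>I \<inter> (\<pp> \<times> M) \<subseteq> (\<pp> \<times> M) \<cdot> I\<close> for every height-one prime \<open>\<pp>\<close>; this is
  \<open>finitely_presented_ideal_inter_subset\<close>, and it says that \<open>Tor\<^sub>1\<close> of \<open>A/\<pp>\<close> and \<open>T/I\<close>
  vanishes.

  Two consequences leave no room for \<open>I\<close>.  If \<open>J = 0\<close>, then every element of \<open>I\<close> lies in
  \<open>(\<pp> \<times> M) \<cdot> I\<close>, whose elements have zero component in every copy of \<open>A/\<pp>\<close>; as this holds
  for all \<open>\<pp>\<close>, the ideal \<open>I\<close> is zero (\<open>ideal_eq_zero_if_fst_zero\<close>).  If \<open>J \<noteq> 0\<close>, take a prime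
  element \<open>p\<close>; it generates a height-one prime since \<open>A\<close> is factorial
  (\<open>PIdl_prime_height_one\<close>), and the inclusion projects to \<open>J \<inter> pA \<subseteq> pJ\<close>
  (\<open>fst_image_divide\<close>).  Hence prime factors can be cancelled from elements of \<open>J\<close>, and
  cancelling all those of a nonzero element leaves a unit in \<open>J\<close>
  (\<open>ideal_eq_carrier_if_prime_divisible\<close>).  Since \<open>0 \<times> M\<close> is nilpotent, \<open>I\<close> then contains a
  unit of \<open>T\<close>.
\<close>

section \<open>Homomorphisms from a free module\<close>

lemma carrier_free_module:
  assumes "cring R"
  shows "carrier (free_module R n) = (\<Pi>\<^sub>E j\<in>{..<n}. carrier R)"
proof -
  have "module R (ideal_module R (carrier R))"
    using assms by (intro module_ideal_module ring.oneideal cring.axioms(1))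
  from carrier_direct_sum[of "{..<n}" R "\<lambda>_. ideal_module R (carrier R)", OF this]
  show ?thesis
    unfolding free_module_def by (auto simp: ideal_module_def)
qed

lemma zero_free_module: "\<zero>\<^bsub>free_module R n\<^esub> = (\<lambda>j\<in>{..<n}. \<zero>\<^bsub>R\<^esub>)"
  by (simp add: free_module_def zero_direct_sum ideal_module_def)

lemma add_free_module: "x \<oplus>\<^bsub>free_module R n\<^esub> y = (\<lambda>j\<in>{..<n}. x j \<oplus>\<^bsub>R\<^esub> y j)"
  by (simp add: free_module_def add_direct_sum ideal_module_def)

lemma smult_free_module: "a \<odot>\<^bsub>free_module R n\<^esub> x = (\<lambda>j\<in>{..<n}. a \<otimes>\<^bsub>R\<^esub> x j)"
  by (simp add: free_module_def smult_direct_sum ideal_module_def)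

lemmas free_module_simps = zero_free_module add_free_module smult_free_module

lemma module_hom_zero:
  assumes M: "module R M" and N: "module R N" and h: "h \<in> module_hom R M N"
  shows "h \<zero>\<^bsub>M\<^esub> = \<zero>\<^bsub>N\<^esub>"
proof -
  interpret M: module R M by fact
  interpret N: module R N by fact
  have "h (\<zero>\<^bsub>R\<^esub> \<odot>\<^bsub>M\<^esub> \<zero>\<^bsub>M\<^esub>) = \<zero>\<^bsub>R\<^esub> \<odot>\<^bsub>N\<^esub> h \<zero>\<^bsub>M\<^esub>"
    using h M.R.zero_closed M.M.zero_closed unfolding module_hom_def by blast
  moreover have "h \<zero>\<^bsub>M\<^esub> \<in> carrier N"
    using h by (auto simp: module_hom_def)
  ultimately show ?thesis by simp
qed

lemma submodule_kernel:
  assumes M: "module R M" and N: "module R N" and h: "h \<in> module_hom R M N"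
  shows "submodule (a_kernel M N h) R M"
proof -
  interpret M: module R M by fact
  interpret N: module R N by fact
  have add: "h (x \<oplus>\<^bsub>M\<^esub> y) = h x \<oplus>\<^bsub>N\<^esub> h y" if "x \<in> carrier M" "y \<in> carrier M" for x y
    using h that by (auto simp: module_hom_def)
  have smult: "h (a \<odot>\<^bsub>M\<^esub> x) = a \<odot>\<^bsub>N\<^esub> h x" if "a \<in> carrier R" "x \<in> carrier M" for a x
    using h that by (auto simp: module_hom_def)
  have neg: "h (\<ominus>\<^bsub>M\<^esub> x) = \<zero>\<^bsub>N\<^esub>" if "x \<in> carrier M" "h x = \<zero>\<^bsub>N\<^esub>" for x
    using smult[of "\<ominus>\<^bsub>R\<^esub> \<one>\<^bsub>R\<^esub>" x] that by (simp add: M.smult_l_minus)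
  show ?thesis
    by (rule M.submoduleI)
      (auto simp: a_kernel_def kernel_def module_hom_zero[OF M N h] add smult neg)
qed

text \<open>
  The image of \<open>y\<close> is the combination of the images of the unit vectors with the entries of
  \<open>y\<close> as coefficients, so it lies in every additively closed set that contains the products of
  these entries with elements of the target.
\<close>

lemma module_hom_free_module_mem:
  assumes R: "cring R" and N: "module R N" and h: "h \<in> module_hom R (free_module R n) N"
    and y: "y \<in> carrier (free_module R n)"
    and zero: "\<zero>\<^bsub>N\<^esub> \<in> L" and add: "\<And>u v. u \<in> L \<Longrightarrow> v \<in> L \<Longrightarrow> u \<oplus>\<^bsub>N\<^esub> v \<in> L"
    and coeff: "\<And>j v. j < n \<Longrightarrow> v \<in> carrier N \<Longrightarrow> y j \<odot>\<^bsub>N\<^esub> v \<in> L"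
  shows "h y \<in> L"
proof -
  interpret R: cring R by fact
  interpret N: module R N by fact
  note F = module_free_module[OF R, of n]
  interpret F: module R "free_module R n" by (rule F)
  note C = carrier_free_module[OF R, of n]
  have hadd: "h (u \<oplus>\<^bsub>free_module R n\<^esub> v) = h u \<oplus>\<^bsub>N\<^esub> h v"
    if "u \<in> carrier (free_module R n)" "v \<in> carrier (free_module R n)" for u v
    using h that by (auto simp: module_hom_def)
  have hsmult: "h (a \<odot>\<^bsub>free_module R n\<^esub> v) = a \<odot>\<^bsub>N\<^esub> h v"
    if "a \<in> carrier R" "v \<in> carrier (free_module R n)" for a v
    using h that by (auto simp: module_hom_def)
  define t where "t m = (\<lambda>j\<in>{..<n}. if j < m then y j else \<zero>\<^bsub>R\<^esub>)" for m
  define d where "d m = (\<lambda>j\<in>{..<n}. if j = m then \<one>\<^bsub>R\<^esub> else \<zero>\<^bsub>R\<^esub>)" for m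
  have yR: "y j \<in> carrier R" if "j < n" for j
    using y that by (auto simp: C)
  have t: "t m \<in> carrier (free_module R n)" for m
    using yR by (auto simp: C t_def)
  have d: "d m \<in> carrier (free_module R n)" for m
    by (auto simp: C d_def)
  have "h (t m) \<in> L" if "m \<le> n" for m
    using that
  proof (induction m)
    case 0
    have "t 0 = \<zero>\<^bsub>free_module R n\<^esub>"
      by (simp add: t_def zero_free_module)
    then show ?case
      using zero by (simp add: module_hom_zero[OF F N h])
  next
    case (Suc m)
    then have m: "m < n" by simp
    have "t (Suc m) = t m \<oplus>\<^bsub>free_module R n\<^esub> (y m \<odot>\<^bsub>free_module R n\<^esub> d m)"
      using yR yR[OF m] by (auto simp: free_module_simps t_def d_def fun_eq_iff less_Suc_eq)
    then have "h (t (Suc m)) = h (t m) \<oplus>\<^bsub>N\<^esub> y m \<odot>\<^bsub>N\<^esub> h (d m)"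
      using t d yR[OF m] by (simp add: hadd hsmult)
    moreover have "h (d m) \<in> carrier N"
      using h d by (auto simp: module_hom_def)
    ultimately show ?case
      using Suc coeff[OF m] add by simp
  qed
  moreover have "t n = y"
    using y by (auto simp: t_def C fun_eq_iff PiE_def extensional_def)
  ultimately show ?thesis by auto
qed

section \<open>Residue classes and components of the direct sum\<close>

context
  fixes R :: "('a, 'm) ring_scheme" and I :: "'a set"
  assumes R: "cring R" and I: "ideal I R"
begin

lemma rcos_eq_ideal_iff:
  assumes "a \<in> carrier R"
  shows "I +>\<^bsub>R\<^esub> a = I \<longleftrightarrow> a \<in> I"
proof -
  interpret I: ideal I R by (rule I)
  show ?thesis
    using I.a_rcos_self[OF assms] I.a_rcos_const[of a] by metis
qed

lemma rcos_simps:
  shows "a \<in> carrier R \<Longrightarrow> I +>\<^bsub>R\<^esub> a \<in> carrier (R Quot I)"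
    and "a \<in> carrier R \<Longrightarrow> b \<in> carrier R \<Longrightarrow>
      (I +>\<^bsub>R\<^esub> a) \<oplus>\<^bsub>R Quot I\<^esub> (I +>\<^bsub>R\<^esub> b) = I +>\<^bsub>R\<^esub> (a \<oplus>\<^bsub>R\<^esub> b)"
    and "a \<in> carrier R \<Longrightarrow> b \<in> carrier R \<Longrightarrow>
      (I +>\<^bsub>R\<^esub> a) \<otimes>\<^bsub>R Quot I\<^esub> (I +>\<^bsub>R\<^esub> b) = I +>\<^bsub>R\<^esub> (a \<otimes>\<^bsub>R\<^esub> b)"
  using ideal.rcos_ring_hom[OF I] by (auto simp: ring_hom_def)

text \<open>
  The zero of the quotient ring is the coset \<open>I\<close> itself, and components of elements of the direct
  sum are compared with it in this form.
\<close>

lemma Quot_zero_simps: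
  shows "I \<in> carrier (R Quot I)" "I \<oplus>\<^bsub>R Quot I\<^esub> I = I"
    and "x \<in> carrier (R Quot I) \<Longrightarrow> I \<otimes>\<^bsub>R Quot I\<^esub> x = I"
    and "x \<in> carrier (R Quot I) \<Longrightarrow> x \<otimes>\<^bsub>R Quot I\<^esub> I = I"
proof -
  interpret Q: cring "R Quot I"
    by (rule ideal.quotient_is_cring[OF I R])
  have Z: "\<zero>\<^bsub>R Quot I\<^esub> = I" by (simp add: FactRing_def)
  show "I \<in> carrier (R Quot I)" "I \<oplus>\<^bsub>R Quot I\<^esub> I = I"
    using Q.zero_closed Q.l_zero[OF Q.zero_closed] by (simp_all only: Z)
  show "x \<in> carrier (R Quot I) \<Longrightarrow> I \<otimes>\<^bsub>R Quot I\<^esub> x = I"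
    using Q.l_null[of x] by (simp only: Z)
  show "x \<in> carrier (R Quot I) \<Longrightarrow> x \<otimes>\<^bsub>R Quot I\<^esub> I = I"
    using Q.r_null[of x] by (simp only: Z)
qed

lemma rcos_eq_imp_minus_mem:
  assumes "a \<in> carrier R" "b \<in> carrier R" "I +>\<^bsub>R\<^esub> a = I +>\<^bsub>R\<^esub> b"
  shows "a \<ominus>\<^bsub>R\<^esub> b \<in> I"
proof -
  interpret R: cring R by (rule R)
  have "I +>\<^bsub>R\<^esub> (a \<ominus>\<^bsub>R\<^esub> b) = I +>\<^bsub>R\<^esub> (b \<ominus>\<^bsub>R\<^esub> b)"
    using assms by (simp add: a_minus_def flip: rcos_simps(2))
  also have "\<dots> = I"
    using assms additive_subgroup.zero_closed[OF ideal.axioms(1)[OF I]]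
    by (simp add: rcos_eq_ideal_iff R.minus_eq R.r_neg)
  finally show ?thesis
    using assms by (simp add: rcos_eq_ideal_iff)
qed

end

text \<open>
  The generator of the copy of \<open>A/\<pp>\<close> with index \<open>k\<close>.  The value \<open>\<qq>\<close> at the other positions is
  the zero coset there.
\<close>

definition unit_M_of ::
    "('a, 'm) ring_scheme \<Rightarrow> 'a set \<Rightarrow> nat \<Rightarrow> 'a set \<Rightarrow> nat \<Rightarrow> 'a set" where
  "unit_M_of A \<pp> k = (\<lambda>\<qq>\<in>height_one_primes A. \<lambda>i. if \<qq> = \<pp> \<and> i = k then \<pp> +>\<^bsub>A\<^esub> \<one>\<^bsub>A\<^esub> else \<qq>)"

lemma T_of_simps:
  "carrier (T_of A) = carrier A \<times> carrier (M_of A)"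
  "\<zero>\<^bsub>T_of A\<^esub> = (\<zero>\<^bsub>A\<^esub>, \<zero>\<^bsub>M_of A\<^esub>)" "\<one>\<^bsub>T_of A\<^esub> = (\<one>\<^bsub>A\<^esub>, \<zero>\<^bsub>M_of A\<^esub>)"
  "s \<oplus>\<^bsub>T_of A\<^esub> t = (fst s \<oplus>\<^bsub>A\<^esub> fst t, snd s \<oplus>\<^bsub>M_of A\<^esub> snd t)"
  "s \<otimes>\<^bsub>T_of A\<^esub> t =
    (fst s \<otimes>\<^bsub>A\<^esub> fst t, (fst s \<odot>\<^bsub>M_of A\<^esub> snd t) \<oplus>\<^bsub>M_of A\<^esub> (fst t \<odot>\<^bsub>M_of A\<^esub> snd s))"
  unfolding T_of_def idealization_def by (simp_all add: split_beta)

context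
  fixes A :: "('a, 'm) ring_scheme"
  assumes A: "cring A"
begin

interpretation A: cring A by (rule A)
interpretation M: module A "M_of A" by (rule module_M_of[OF A])
interpretation T: cring "T_of A" by (rule cring_T_of[OF A])

lemma height_one_prime_ideal: "\<pp> \<in> height_one_primes A \<Longrightarrow> ideal \<pp> A"
  by (simp add: height_one_primes_def primeideal_def)

lemmas rcos_height_one_prime =
  rcos_eq_ideal_iff[OF A height_one_prime_ideal] rcos_simps[OF A height_one_prime_ideal]
  Quot_zero_simps[OF A height_one_prime_ideal]

lemma carrier_M_of:
  "carrier (M_of A) =
    {m \<in> \<Pi>\<^sub>E \<pp>\<in>height_one_primes A.
        {x. (\<forall>k. x k \<in> carrier (A Quot \<pp>)) \<and> finite {k. x k \<noteq> \<pp>}}.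
      finite {\<pp> \<in> height_one_primes A. m \<pp> \<noteq> (\<lambda>k. \<pp>)}}"
proof -
  have Q: "module A (quotient_module A \<pp>)" if "\<pp> \<in> height_one_primes A" for \<pp>
    using that by (intro module_quotient_module A height_one_prime_ideal)
  have Q_simps: "carrier (quotient_module A \<pp>) = carrier (A Quot \<pp>)"
      "\<zero>\<^bsub>quotient_module A \<pp>\<^esub> = \<pp>" for \<pp>
    by (simp_all add: quotient_module_def FactRing_def)
  have C: "carrier (countable_power (quotient_module A \<pp>)) =
      {x. (\<forall>k. x k \<in> carrier (A Quot \<pp>)) \<and> finite {k. x k \<noteq> \<pp>}}"
    if "\<pp> \<in> height_one_primes A" for \<pp>
    unfolding countable_power_def carrier_direct_sum[OF Q[OF that]] Q_simps
    by (auto simp: PiE_UNIV_domain Pi_iff)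
  have Z: "\<zero>\<^bsub>countable_power (quotient_module A \<pp>)\<^esub> = (\<lambda>k. \<pp>)" for \<pp>
    by (simp add: countable_power_def zero_direct_sum Q_simps fun_eq_iff)
  have P: "module A (countable_power (quotient_module A \<pp>))" if "\<pp> \<in> height_one_primes A" for \<pp>
    unfolding countable_power_def using that Q by (intro module_direct_sum A)
  have "carrier (M_of A) =
    {m \<in> \<Pi>\<^sub>E \<pp>\<in>height_one_primes A. carrier (countable_power (quotient_module A \<pp>)).
      finite {\<pp> \<in> height_one_primes A. m \<pp> \<noteq> \<zero>\<^bsub>countable_power (quotient_module A \<pp>)\<^esub>}}"
    unfolding M_of_def by (rule carrier_direct_sum) (rule P)
  then show ?thesis
    by (simp add: Z C cong: PiE_cong)
qed

lemma zero_M_of: "\<pp> \<in> height_one_primes A \<Longrightarrow> \<zero>\<^bsub>M_of A\<^esub> \<pp> k = \<pp>"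
  by (simp add: M_of_def countable_power_def zero_direct_sum quotient_module_def FactRing_def)

lemma add_M_of:
  "\<pp> \<in> height_one_primes A \<Longrightarrow> (m \<oplus>\<^bsub>M_of A\<^esub> m') \<pp> k = m \<pp> k \<oplus>\<^bsub>A Quot \<pp>\<^esub> m' \<pp> k"
  by (simp add: M_of_def countable_power_def add_direct_sum quotient_module_def)

lemma smult_M_of:
  "\<pp> \<in> height_one_primes A \<Longrightarrow>
    (a \<odot>\<^bsub>M_of A\<^esub> m) \<pp> k = (\<pp> +>\<^bsub>A\<^esub> a) \<otimes>\<^bsub>A Quot \<pp>\<^esub> m \<pp> k"
  by (simp add: M_of_def countable_power_def smult_direct_sum quotient_module_def)

lemma M_of_component_closed:
  "m \<in> carrier (M_of A) \<Longrightarrow> \<pp> \<in> height_one_primes A \<Longrightarrow> m \<pp> k \<in> carrier (A Quot \<pp>)"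
  by (auto simp: carrier_M_of)

lemma finite_M_of_component:
  "m \<in> carrier (M_of A) \<Longrightarrow> \<pp> \<in> height_one_primes A \<Longrightarrow> finite {k. m \<pp> k \<noteq> \<pp>}"
  by (auto simp: carrier_M_of)

lemma M_of_eq_zeroI:
  assumes m: "m \<in> carrier (M_of A)" and z: "\<And>\<pp> k. \<pp> \<in> height_one_primes A \<Longrightarrow> m \<pp> k = \<pp>"
  shows "m = \<zero>\<^bsub>M_of A\<^esub>"
proof
  fix \<pp>
  show "m \<pp> = \<zero>\<^bsub>M_of A\<^esub> \<pp>"
  proof (cases "\<pp> \<in> height_one_primes A")
    case True
    then show ?thesis by (simp add: fun_eq_iff z zero_M_of)
  next
    case False
    then show ?thesis
      using m M.zero_closed by (auto simp: carrier_M_of PiE_def extensional_def)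
  qed
qed

lemma unit_M_of_closed:
  assumes \<pp>: "\<pp> \<in> height_one_primes A"
  shows "unit_M_of A \<pp> k \<in> carrier (M_of A)"
proof -
  have "unit_M_of A \<pp> k \<qq> \<in> {x. (\<forall>i. x i \<in> carrier (A Quot \<qq>)) \<and> finite {i. x i \<noteq> \<qq>}}"
    if \<qq>: "\<qq> \<in> height_one_primes A" for \<qq>
  proof (intro CollectI conjI allI)
    show "unit_M_of A \<pp> k \<qq> i \<in> carrier (A Quot \<qq>)" for i
      using rcos_height_one_prime(2)[OF \<qq> A.one_closed] rcos_height_one_prime(5)[OF \<qq>] \<qq>
      by (auto simp: unit_M_of_def)
    show "finite {i. unit_M_of A \<pp> k \<qq> i \<noteq> \<qq>}"
      by (rule finite_subset[of _ "{k}"]) (auto simp: unit_M_of_def \<qq>)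
  qed
  then have "unit_M_of A \<pp> k \<in> (\<Pi>\<^sub>E \<qq>\<in>height_one_primes A.
      {x. (\<forall>i. x i \<in> carrier (A Quot \<qq>)) \<and> finite {i. x i \<noteq> \<qq>}})"
    by (rule PiE_I) (simp_all add: unit_M_of_def)
  moreover have "finite {\<qq> \<in> height_one_primes A. unit_M_of A \<pp> k \<qq> \<noteq> (\<lambda>i. \<qq>)}"
    by (rule finite_subset[of _ "{\<pp>}"]) (auto simp: unit_M_of_def fun_eq_iff)
  ultimately show ?thesis
    unfolding carrier_M_of mem_Collect_eq by (rule conjI)
qed

lemma smult_unit_M_of:
  assumes \<pp>: "\<pp> \<in> height_one_primes A" and a: "a \<in> carrier A"
  shows "(a \<odot>\<^bsub>M_of A\<^esub> unit_M_of A \<pp> k) \<pp> k = \<pp> +>\<^bsub>A\<^esub> a"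
proof -
  have "unit_M_of A \<pp> k \<pp> k = \<pp> +>\<^bsub>A\<^esub> \<one>\<^bsub>A\<^esub>"
    using \<pp> by (simp add: unit_M_of_def)
  then show ?thesis
    using a by (simp add: smult_M_of[OF \<pp>] rcos_height_one_prime(4)[OF \<pp>])
qed

lemma smult_unit_M_of_eq_zero:
  assumes \<pp>: "\<pp> \<in> height_one_primes A" and a: "a \<in> \<pp>"
  shows "a \<odot>\<^bsub>M_of A\<^esub> unit_M_of A \<pp> k = \<zero>\<^bsub>M_of A\<^esub>"
proof (rule M_of_eq_zeroI)
  have aA: "a \<in> carrier A"
    using height_one_prime_ideal[OF \<pp>] a by (rule ideal.Icarr)
  then show "a \<odot>\<^bsub>M_of A\<^esub> unit_M_of A \<pp> k \<in> carrier (M_of A)"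
    by (intro M.smult_closed unit_M_of_closed \<pp>)
  fix \<qq> i
  assume \<qq>: "\<qq> \<in> height_one_primes A"
  show "(a \<odot>\<^bsub>M_of A\<^esub> unit_M_of A \<pp> k) \<qq> i = \<qq>"
  proof (cases "\<qq> = \<pp> \<and> i = k")
    case True
    then show ?thesis
      using smult_unit_M_of[OF \<pp> aA] rcos_height_one_prime(1)[OF \<pp> aA] a by simp
  next
    case False
    then have "unit_M_of A \<pp> k \<qq> i = \<qq>"
      using \<qq> by (auto simp: unit_M_of_def)
    then show ?thesis
      using rcos_height_one_prime(8)[OF \<qq> rcos_height_one_prime(2)[OF \<qq> aA]]
      by (simp add: smult_M_of[OF \<qq>])
  qed
qed

section \<open>Finitely presented ideals of the idealization\<close>

lemma free_module_T_of_entry: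
  assumes "y \<in> carrier (free_module (T_of A) n)" "j < n"
  shows "fst (y j) \<in> carrier A" "snd (y j) \<in> carrier (M_of A)"
  using assms
  by (auto simp: carrier_free_module[OF cring_T_of[OF A]] T_of_simps(1) PiE_iff mem_Times_iff)

text \<open>
  Choose the copy \<open>k\<close> of \<open>A/\<pp>\<close> outside the supports of the finitely many entries of elements of
  \<open>S\<close>.  The vectors of \<open>K\<close> whose entries in this copy come from the ring components of another
  vector of \<open>K\<close> form a submodule: by the multiplication rule of the idealization, \<open>(b, f) y\<close> has
  the entries \<open>b y\<^sub>k + f\<^sub>k y\<^sub>A\<close> there, and if \<open>x\<close> lifts \<open>y\<close> and \<open>g\<close> lifts \<open>f\<^sub>k\<close>, then
  \<open>b x + g y\<close> lifts this.  The submodule contains \<open>S\<close>, whose elements vanish in the copy and are lifted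
  by zero.
\<close>

lemma span_component_lift:
  assumes K: "submodule K (T_of A) (free_module (T_of A) n)"
    and S: "finite S" "S \<subseteq> K" and \<pp>: "\<pp> \<in> height_one_primes A"
  obtains k where "\<And>y. y \<in> module_span (T_of A) (free_module (T_of A) n) S \<Longrightarrow>
    \<exists>x\<in>K. \<forall>j<n. snd (y j) \<pp> k = \<pp> +>\<^bsub>A\<^esub> fst (x j)"
proof -
  let ?F = "free_module (T_of A) n"
  interpret F: module "T_of A" ?F
    by (rule module_free_module[OF cring_T_of[OF A]])
  interpret K: submodule K "T_of A" ?F by (rule K)
  have Z: "\<pp> +>\<^bsub>A\<^esub> \<zero>\<^bsub>A\<^esub> = \<pp>"
    using rcos_height_one_prime(1)[OF \<pp> A.zero_closed] height_one_prime_ideal[OF \<pp>]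
    by (simp add: ideal_def additive_subgroup.zero_closed)
  have KF: "y \<in> carrier ?F" if "y \<in> K" for y
    using K.subset that by auto
  have "finite (\<Union>s\<in>S. \<Union>j<n. {k. snd (s j) \<pp> k \<noteq> \<pp>})"
  proof (intro finite_UN_I finite_M_of_component \<pp> S(1) finite_lessThan)
    show "snd (s j) \<in> carrier (M_of A)" if "s \<in> S" "j \<in> {..<n}" for s j
      by (rule free_module_T_of_entry(2)[OF KF]) (use that S(2) in auto)
  qed
  then obtain k where k: "k \<notin> (\<Union>s\<in>S. \<Union>j<n. {k. snd (s j) \<pp> k \<noteq> \<pp>})"
    using ex_new_if_finite[OF infinite_UNIV_nat] by blast
  define H where "H = {y\<in>K. \<exists>x\<in>K. \<forall>j<n. snd (y j) \<pp> k = \<pp> +>\<^bsub>A\<^esub> fst (x j)}"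
  have smult: "t \<odot>\<^bsub>?F\<^esub> y \<in> H" if t: "t \<in> carrier (T_of A)" and y: "y \<in> H" for t y
  proof -
    obtain x where x: "x \<in> K" "\<And>j. j < n \<Longrightarrow> snd (y j) \<pp> k = \<pp> +>\<^bsub>A\<^esub> fst (x j)" and yK: "y \<in> K"
      using y by (auto simp: H_def)
    have t': "fst t \<in> carrier A" "snd t \<in> carrier (M_of A)"
      using t by (auto simp: T_of_simps)
    obtain g where g: "g \<in> carrier A" "snd t \<pp> k = \<pp> +>\<^bsub>A\<^esub> g"
      using M_of_component_closed[OF t'(2) \<pp>, of k] by (auto simp: FactRing_def A_RCOSETS_def')
    let ?b = "(fst t, \<zero>\<^bsub>M_of A\<^esub>)" and ?g = "(g, \<zero>\<^bsub>M_of A\<^esub>)"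
    have bg: "?b \<in> carrier (T_of A)" "?g \<in> carrier (T_of A)"
      using t' g by (auto simp: T_of_simps)
    have "(?b \<odot>\<^bsub>?F\<^esub> x) \<oplus>\<^bsub>?F\<^esub> (?g \<odot>\<^bsub>?F\<^esub> y) \<in> K"
      using K.smult_closed[OF bg(1) x(1)] K.smult_closed[OF bg(2) yK] K.m_closed by simp
    moreover have "snd ((t \<odot>\<^bsub>?F\<^esub> y) j) \<pp> k =
        \<pp> +>\<^bsub>A\<^esub> fst (((?b \<odot>\<^bsub>?F\<^esub> x) \<oplus>\<^bsub>?F\<^esub> (?g \<odot>\<^bsub>?F\<^esub> y)) j)" if j: "j < n" for j
    proof -
      note e = free_module_T_of_entry[OF KF[OF x(1)] j] free_module_T_of_entry[OF KF[OF yK] j]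
      show ?thesis
        using j e t' g(1)
        by (simp add: free_module_simps T_of_simps add_M_of[OF \<pp>] smult_M_of[OF \<pp>] x(2) g(2)
            rcos_height_one_prime(3,4)[OF \<pp>] A.m_comm[of g])
    qed
    ultimately show ?thesis
      using K.smult_closed[OF t yK] by (auto simp: H_def)
  qed
  have "submodule H (T_of A) ?F"
  proof (rule F.submoduleI)
    show "H \<subseteq> carrier ?F"
      using KF by (auto simp: H_def)
    have 0: "\<zero>\<^bsub>?F\<^esub> \<in> K" using K.one_closed by simp
    show "\<zero>\<^bsub>?F\<^esub> \<in> H"
      using 0 by (auto simp: H_def zero_free_module T_of_simps zero_M_of[OF \<pp>] Z intro!: bexI[OF _ 0])
    show "y \<oplus>\<^bsub>?F\<^esub> y' \<in> H" if yH: "y \<in> H" "y' \<in> H" for y y'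
    proof -
      obtain x x' where x: "x \<in> K" "\<And>j. j < n \<Longrightarrow> snd (y j) \<pp> k = \<pp> +>\<^bsub>A\<^esub> fst (x j)"
        and x': "x' \<in> K" "\<And>j. j < n \<Longrightarrow> snd (y' j) \<pp> k = \<pp> +>\<^bsub>A\<^esub> fst (x' j)"
        and y: "y \<in> K" "y' \<in> K"
        using yH by (auto simp: H_def)
      have "x \<oplus>\<^bsub>?F\<^esub> x' \<in> K" "y \<oplus>\<^bsub>?F\<^esub> y' \<in> K"
        using K.m_closed x x' y by auto
      moreover have "snd ((y \<oplus>\<^bsub>?F\<^esub> y') j) \<pp> k = \<pp> +>\<^bsub>A\<^esub> fst ((x \<oplus>\<^bsub>?F\<^esub> x') j)" if j: "j < n" for j
        using j free_module_T_of_entry[OF KF[OF x(1)] j] free_module_T_of_entry[OF KF[OF x'(1)] j]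
        by (simp add: add_free_module T_of_simps add_M_of[OF \<pp>] x(2) x'(2)
            rcos_height_one_prime(3)[OF \<pp>])
      ultimately show ?thesis by (auto simp: H_def)
    qed
    show "\<ominus>\<^bsub>?F\<^esub> y \<in> H" if "y \<in> H" for y
    proof -
      have "y \<in> carrier ?F" using that KF by (auto simp: H_def)
      then have "\<ominus>\<^bsub>?F\<^esub> y = (\<ominus>\<^bsub>T_of A\<^esub> \<one>\<^bsub>T_of A\<^esub>) \<odot>\<^bsub>?F\<^esub> y"
        by (simp add: F.smult_l_minus)
      then show ?thesis using smult that by simp
    qed
  qed (rule smult)
  moreover have "S \<subseteq> H"
  proof
    fix s assume s: "s \<in> S"
    have 0: "\<zero>\<^bsub>?F\<^esub> \<in> K" using K.one_closed by simp
    have "snd (s j) \<pp> k = \<pp>" if "j < n" for j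
      using k s that by blast
    then show "s \<in> H"
      using s S by (auto simp: H_def zero_free_module T_of_simps Z intro!: bexI[OF _ 0])
  qed
  ultimately have "module_span (T_of A) ?F S \<subseteq> H"
    by (auto simp: module_span_def)
  then show thesis
    by (intro that[of k]) (auto simp: H_def)
qed

text \<open>
  Tensoring with \<open>A/\<pp>\<close> keeps \<open>I \<rightarrow> T\<close> injective.  Only the ring component of the coefficients
  of an element of \<open>I\<close> matters modulo \<open>\<pp> \<times> M\<close>, and multiplication by the generator of a
  copy of \<open>A/\<pp>\<close> makes exactly this component visible in that copy.
\<close>

lemma finitely_presented_ideal_inter_subset:
  assumes I: "ideal I (T_of A)" and fp: "finitely_presented (T_of A) (ideal_module (T_of A) I)"
    and \<pp>: "\<pp> \<in> height_one_primes A"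
  shows "I \<inter> (\<pp> \<times> carrier (M_of A)) \<subseteq> (\<pp> \<times> carrier (M_of A)) \<cdot>\<^bsub>T_of A\<^esub> I"
proof
  fix v assume v: "v \<in> I \<inter> (\<pp> \<times> carrier (M_of A))"
  let ?N = "ideal_module (T_of A) I"
  have N: "module (T_of A) ?N"
    by (rule module_ideal_module[OF cring_T_of[OF A] I])
  have N_simps: "carrier ?N = I" "\<zero>\<^bsub>?N\<^esub> = \<zero>\<^bsub>T_of A\<^esub>" "add ?N = add (T_of A)" "smult ?N = mult (T_of A)"
    by (simp_all add: ideal_module_def)
  interpret I: ideal I "T_of A" by (rule I)
  interpret P: ideal \<pp> A by (rule height_one_prime_ideal[OF \<pp>])
  from fp obtain n h S where h: "h \<in> module_hom (T_of A) (free_module (T_of A) n) ?N"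
    and surj: "h ` carrier (free_module (T_of A) n) = carrier ?N"
    and S: "finite S"
      "a_kernel (free_module (T_of A) n) ?N h = module_span (T_of A) (free_module (T_of A) n) S"
    by (auto simp: finitely_presented_def finitely_generated_submodule_def)
  let ?F = "free_module (T_of A) n" and ?K = "a_kernel (free_module (T_of A) n) ?N h"
  have F: "module (T_of A) ?F"
    by (rule module_free_module[OF cring_T_of[OF A]])
  interpret F: module "T_of A" ?F by (rule F)
  have "S \<subseteq> ?K" unfolding S(2) by (auto simp: module_span_def)
  then obtain k where k: "\<And>y. y \<in> ?K \<Longrightarrow> \<exists>x\<in>?K. \<forall>j<n. snd (y j) \<pp> k = \<pp> +>\<^bsub>A\<^esub> fst (x j)"
    using span_component_lift[OF submodule_kernel[OF F N h] S(1) _ \<pp>] S(2) by metis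
  obtain y where y: "y \<in> carrier ?F" "h y = v"
    using surj v by (auto simp: N_simps)
  have hadd: "h (a \<oplus>\<^bsub>?F\<^esub> b) = h a \<oplus>\<^bsub>T_of A\<^esub> h b" if "a \<in> carrier ?F" "b \<in> carrier ?F" for a b
    using h that by (auto simp: module_hom_def N_simps)
  have hsmult: "h (t \<odot>\<^bsub>?F\<^esub> b) = t \<otimes>\<^bsub>T_of A\<^esub> h b" if "t \<in> carrier (T_of A)" "b \<in> carrier ?F" for t b
    using h that by (auto simp: module_hom_def N_simps)
  let ?u = "unit_M_of A \<pp> k" and ?e = "(\<zero>\<^bsub>A\<^esub>, unit_M_of A \<pp> k)"
  have u: "?u \<in> carrier (M_of A)" by (rule unit_M_of_closed[OF \<pp>])
  then have e: "?e \<in> carrier (T_of A)" by (simp add: T_of_simps)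
  \<comment> \<open>The factor \<open>?e\<close> is annihilated by \<open>\<pp>\<close>, so it turns the preimage of \<open>v\<close> into a relation.\<close>
  have "h (?e \<odot>\<^bsub>?F\<^esub> y) = ?e \<otimes>\<^bsub>T_of A\<^esub> v"
    by (simp add: hsmult[OF e y(1)] y(2))
  also have "\<dots> = \<zero>\<^bsub>T_of A\<^esub>"
    using v u by (auto simp: T_of_simps smult_unit_M_of_eq_zero \<pp>)
  finally have "?e \<odot>\<^bsub>?F\<^esub> y \<in> ?K"
    using F.smult_closed[OF e y(1)] by (simp add: a_kernel_def kernel_def N_simps)
  from k[OF this] obtain x where x: "x \<in> carrier ?F" "h x = \<zero>\<^bsub>T_of A\<^esub>"
    and eq: "\<And>j. j < n \<Longrightarrow> snd ((?e \<odot>\<^bsub>?F\<^esub> y) j) \<pp> k = \<pp> +>\<^bsub>A\<^esub> fst (x j)"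
    by (auto simp: a_kernel_def kernel_def N_simps)
  \<comment> \<open>Subtracting the relation \<open>x\<close> moves all coefficients into \<open>\<pp> \<times> M\<close>.\<close>
  let ?c = "(\<ominus>\<^bsub>A\<^esub> \<one>\<^bsub>A\<^esub>, \<zero>\<^bsub>M_of A\<^esub>)"
  let ?w = "y \<oplus>\<^bsub>?F\<^esub> (?c \<odot>\<^bsub>?F\<^esub> x)"
  have c: "?c \<in> carrier (T_of A)" by (simp add: T_of_simps)
  have cx: "?c \<odot>\<^bsub>?F\<^esub> x \<in> carrier ?F" using c x by simp
  then have w: "?w \<in> carrier ?F" using y by simp
  have wP: "?w j \<in> \<pp> \<times> carrier (M_of A)" if j: "j < n" for j
  proof -
    note ej = free_module_T_of_entry[OF x(1) j] free_module_T_of_entry[OF y(1) j]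
    have "\<pp> +>\<^bsub>A\<^esub> fst (y j) = \<pp> +>\<^bsub>A\<^esub> fst (x j)"
      using eq[OF j] j ej u
      by (simp add: smult_free_module T_of_simps smult_unit_M_of \<pp>)
    then have "fst (y j) \<ominus>\<^bsub>A\<^esub> fst (x j) \<in> \<pp>"
      by (intro rcos_eq_imp_minus_mem[OF A P.ideal_axioms]) (use ej in auto)
    moreover have "fst (?w j) = fst (y j) \<ominus>\<^bsub>A\<^esub> fst (x j)"
      using j ej by (simp add: free_module_simps T_of_simps a_minus_def A.l_minus)
    ultimately show ?thesis
      using free_module_T_of_entry[OF w j] by (simp add: mem_Times_iff)
  qed
  have "h ?w = h y \<oplus>\<^bsub>T_of A\<^esub> (?c \<otimes>\<^bsub>T_of A\<^esub> h x)"
    by (simp add: hadd[OF y(1) cx] hsmult[OF c x(1)])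
  also have "\<dots> = v"
    using v x y c I.Icarr by simp
  finally have hw: "h ?w = v" .
  show "v \<in> (\<pp> \<times> carrier (M_of A)) \<cdot>\<^bsub>T_of A\<^esub> I"
    unfolding hw[symmetric]
  proof (rule module_hom_free_module_mem[OF cring_T_of[OF A] N h w])
    have "\<zero>\<^bsub>T_of A\<^esub> \<in> \<pp> \<times> carrier (M_of A)" by (simp add: T_of_simps)
    from ideal_prod.prod[OF this I.zero_closed, of "T_of A"]
    show "\<zero>\<^bsub>?N\<^esub> \<in> (\<pp> \<times> carrier (M_of A)) \<cdot>\<^bsub>T_of A\<^esub> I" by (simp add: N_simps)
  qed (auto simp: N_simps intro: ideal_prod.intros wP)
qed

lemma ideal_fst_image:
  assumes I: "ideal I (T_of A)"
  shows "ideal (fst ` I) A"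
proof -
  interpret I: ideal I "T_of A" by (rule I)
  have mem: "fst v \<in> carrier A" "snd v \<in> carrier (M_of A)" if "v \<in> I" for v
    using I.Icarr[OF that] by (auto simp: T_of_simps)
  have add: "a \<oplus>\<^bsub>A\<^esub> b \<in> fst ` I" if ab: "a \<in> fst ` I" "b \<in> fst ` I" for a b
  proof -
    obtain v w where vw: "v \<in> I" "w \<in> I" "a = fst v" "b = fst w" using ab by auto
    then have "fst (v \<oplus>\<^bsub>T_of A\<^esub> w) \<in> fst ` I" by blast
    then show ?thesis by (simp add: T_of_simps vw)
  qed
  have mult: "r \<otimes>\<^bsub>A\<^esub> a \<in> fst ` I" if ra: "r \<in> carrier A" "a \<in> fst ` I" for r a
  proof -
    obtain v where v: "v \<in> I" "a = fst v" using ra by auto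
    have "(r, \<zero>\<^bsub>M_of A\<^esub>) \<otimes>\<^bsub>T_of A\<^esub> v \<in> I"
      by (rule I.I_l_closed[OF v(1)]) (simp add: T_of_simps ra)
    then have "fst ((r, \<zero>\<^bsub>M_of A\<^esub>) \<otimes>\<^bsub>T_of A\<^esub> v) \<in> fst ` I" by blast
    then show ?thesis by (simp add: T_of_simps v)
  qed
  show ?thesis
  proof (rule idealI[OF A.ring_axioms])
    show "subgroup (fst ` I) (add_monoid A)"
    proof (rule A.add.subgroupI)
      show "fst ` I \<subseteq> carrier A" using mem by auto
      show "fst ` I \<noteq> {}" using I.zero_closed by blast
      show "\<ominus>\<^bsub>A\<^esub> a \<in> fst ` I" if a: "a \<in> fst ` I" for a
      proof -
        have "a \<in> carrier A" using a mem by blast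
        then show ?thesis
          using mult[OF A.a_inv_closed[OF A.one_closed] a] by (simp add: A.l_minus)
      qed
    qed (rule add)
    show "r \<otimes>\<^bsub>A\<^esub> a \<in> fst ` I" if "a \<in> fst ` I" "r \<in> carrier A" for a r
      using mult that by blast
    show "a \<otimes>\<^bsub>A\<^esub> r \<in> fst ` I" if "a \<in> fst ` I" "r \<in> carrier A" for a r
      using mult that mem A.m_comm by (metis imageE)
  qed
qed

text \<open>The element \<open>(1, e)\<close> is a unit with inverse \<open>(1, - e)\<close>, since \<open>(0, e)\<close> has square zero.\<close>

lemma ideal_eq_carrier_if_one_mem_fst:
  assumes I: "ideal I (T_of A)" and one: "\<one>\<^bsub>A\<^esub> \<in> fst ` I"
  shows "I = carrier (T_of A)"
proof -
  interpret I: ideal I "T_of A" by (rule I)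
  obtain e where v: "(\<one>\<^bsub>A\<^esub>, e) \<in> I" using one by auto
  then have e: "e \<in> carrier (M_of A)" using I.Icarr by (auto simp: T_of_simps)
  have "(\<one>\<^bsub>A\<^esub>, \<ominus>\<^bsub>M_of A\<^esub> e) \<otimes>\<^bsub>T_of A\<^esub> (\<one>\<^bsub>A\<^esub>, e) \<in> I"
    by (rule I.I_l_closed[OF v]) (simp add: T_of_simps e)
  then have "\<one>\<^bsub>T_of A\<^esub> \<in> I"
    using e by (simp add: T_of_simps M.r_neg)
  then show ?thesis by (rule I.one_imp_carrier)
qed

text \<open>
  Every element of \<open>I\<close> lies in \<open>(\<pp> \<times> M) \<cdot> I\<close>, and there the product of \<open>(a, m)\<close> and \<open>(0, w)\<close>
  is \<open>(0, a w)\<close> with \<open>a \<in> \<pp>\<close>, which vanishes in \<open>A/\<pp>\<close>.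
\<close>

lemma ideal_eq_zero_if_fst_zero:
  assumes I: "ideal I (T_of A)" and fp: "finitely_presented (T_of A) (ideal_module (T_of A) I)"
    and zero: "fst ` I = {\<zero>\<^bsub>A\<^esub>}"
  shows "I = {\<zero>\<^bsub>T_of A\<^esub>}"
proof -
  interpret I: ideal I "T_of A" by (rule I)
  have mem: "fst v = \<zero>\<^bsub>A\<^esub>" "snd v \<in> carrier (M_of A)" if "v \<in> I" for v
    using I.Icarr[OF that] zero that by (auto simp: T_of_simps)
  have "snd v \<pp> k = \<pp>" if v: "v \<in> I" and \<pp>: "\<pp> \<in> height_one_primes A" for v \<pp> k
  proof -
    have "v \<in> I \<inter> (\<pp> \<times> carrier (M_of A))"
      using v mem[OF v] additive_subgroup.zero_closed[OF ideal.axioms(1)[OF height_one_prime_ideal[OF \<pp>]]]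
      by (simp add: mem_Times_iff)
    then have "v \<in> (\<pp> \<times> carrier (M_of A)) \<cdot>\<^bsub>T_of A\<^esub> I"
      using finitely_presented_ideal_inter_subset[OF I fp \<pp>] by blast
    then show ?thesis
    proof induction
      case (prod i w)
      then have i: "fst i \<in> \<pp>" "snd i \<in> carrier (M_of A)" by auto
      have iA: "fst i \<in> carrier A"
        using height_one_prime_ideal[OF \<pp>] i(1) by (rule ideal.Icarr)
      have "(fst i \<odot>\<^bsub>M_of A\<^esub> snd w) \<pp> k = \<pp>"
        using rcos_height_one_prime(1)[OF \<pp> iA] i(1)
          rcos_height_one_prime(7)[OF \<pp> M_of_component_closed[OF mem(2)[OF prod(2)] \<pp>]]
        by (simp add: smult_M_of[OF \<pp>])
      moreover have "fst w \<odot>\<^bsub>M_of A\<^esub> snd i = \<zero>\<^bsub>M_of A\<^esub>"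
        using i(2) mem(1)[OF prod(2)] by simp
      ultimately show ?case
        by (simp add: T_of_simps add_M_of[OF \<pp>] zero_M_of[OF \<pp>] rcos_height_one_prime(6)[OF \<pp>])
    next
      case (sum s t)
      then show ?case by (simp add: T_of_simps add_M_of[OF \<pp>] rcos_height_one_prime(6)[OF \<pp>])
    qed
  qed
  then have "v = \<zero>\<^bsub>T_of A\<^esub>" if "v \<in> I" for v
    using M_of_eq_zeroI mem that by (auto simp: T_of_simps prod_eq_iff)
  then show ?thesis using I.zero_closed by blast
qed

text \<open>
  The projection to \<open>A\<close> of the inclusion \<open>I \<inter> (\<pp> \<times> M) \<subseteq> (\<pp> \<times> M) \<cdot> I\<close> for \<open>\<pp> = pA\<close>:
  a multiple of \<open>p\<close> in the image of \<open>I\<close> lies in \<open>p\<close> times this image.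
\<close>

lemma fst_image_divide:
  assumes I: "ideal I (T_of A)" and fp: "finitely_presented (T_of A) (ideal_module (T_of A) I)"
    and p: "p \<in> carrier A" "PIdl\<^bsub>A\<^esub> p \<in> height_one_primes A"
    and a: "a \<in> carrier A" "p \<otimes>\<^bsub>A\<^esub> a \<in> fst ` I"
  shows "\<exists>b\<in>fst ` I. p \<otimes>\<^bsub>A\<^esub> a = p \<otimes>\<^bsub>A\<^esub> b"
proof -
  interpret I: ideal I "T_of A" by (rule I)
  interpret J: ideal "fst ` I" A by (rule ideal_fst_image[OF I])
  obtain v where v: "v \<in> I" "fst v = p \<otimes>\<^bsub>A\<^esub> a" using a by auto
  have "fst v \<in> PIdl\<^bsub>A\<^esub> p"
    using a p v by (auto simp: cgenideal_def A.m_comm)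
  then have "v \<in> I \<inter> ((PIdl\<^bsub>A\<^esub> p) \<times> carrier (M_of A))"
    using v(1) I.Icarr[OF v(1)] by (auto simp: T_of_simps)
  then have "v \<in> ((PIdl\<^bsub>A\<^esub> p) \<times> carrier (M_of A)) \<cdot>\<^bsub>T_of A\<^esub> I"
    using finitely_presented_ideal_inter_subset[OF I fp p(2)] by blast
  then have "\<exists>b\<in>fst ` I. fst v = p \<otimes>\<^bsub>A\<^esub> b"
  proof induction
    case (prod i w)
    then obtain r where r: "r \<in> carrier A" "fst i = r \<otimes>\<^bsub>A\<^esub> p"
      by (auto simp: cgenideal_def)
    have w: "fst w \<in> fst ` I" using prod by blast
    have "r \<otimes>\<^bsub>A\<^esub> fst w \<in> fst ` I" by (rule J.I_l_closed[OF w r(1)])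
    moreover have "fst (i \<otimes>\<^bsub>T_of A\<^esub> w) = p \<otimes>\<^bsub>A\<^esub> (r \<otimes>\<^bsub>A\<^esub> fst w)"
      using r p J.Icarr[OF w] by (simp add: T_of_simps A.m_ac)
    ultimately show ?case by blast
  next
    case (sum s t)
    then obtain b c where bc: "b \<in> fst ` I" "c \<in> fst ` I"
      "fst s = p \<otimes>\<^bsub>A\<^esub> b" "fst t = p \<otimes>\<^bsub>A\<^esub> c" by blast
    have "fst (s \<oplus>\<^bsub>T_of A\<^esub> t) = p \<otimes>\<^bsub>A\<^esub> (b \<oplus>\<^bsub>A\<^esub> c)"
      using bc p J.Icarr by (simp add: T_of_simps A.r_distr)
    then show ?case using J.a_closed[OF bc(1,2)] by blast
  qed
  then show ?thesis by (simp add: v)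
qed

end

section \<open>Factorial domains\<close>

context factorial_domain
begin

lemma prime_product_induct:
  assumes a: "a \<in> carrier R" "a \<noteq> \<zero>"
    and unit: "\<And>u. u \<in> Units R \<Longrightarrow> P u"
    and prime: "\<And>p b. p \<in> carrier R \<Longrightarrow> ring_prime p \<Longrightarrow> b \<in> carrier R \<Longrightarrow> P b \<Longrightarrow> P (p \<otimes> b)"
  shows "P a"
proof (cases "a \<in> Units R")
  case False
  then obtain fs where fs: "set fs \<subseteq> carrier (mult_of R)" "factors (mult_of R) fs a"
    using factors_exist[of a] a by auto
  have "foldr (\<otimes>) fs \<one> \<in> carrier R \<and> P (foldr (\<otimes>) fs \<one>)"
    if "set fs \<subseteq> carrier (mult_of R)" "\<forall>x\<in>set fs. irreducible (mult_of R) x" for fs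
    using that
  proof (induction fs)
    case Nil
    then show ?case by (simp add: unit)
  next
    case (Cons p fs)
    then have "prime (mult_of R) p"
      by (intro factorial_monoid.irreducible_prime[OF factorial_monoid_axioms]) auto
    then have "ring_prime p"
      using Cons.prems by (intro ring_primeI') auto
    then show ?case using Cons by (auto intro: prime)
  qed
  then show ?thesis using fs by (auto simp: factors_def)
qed (rule unit)

lemma nonzero_primeideal_contains_prime:
  assumes "primeideal P R" "P \<noteq> {\<zero>}"
  obtains p where "p \<in> P" "ring_prime p"
proof -
  interpret P: primeideal P R by fact
  obtain a where a: "a \<in> P" "a \<noteq> \<zero>" using assms(2) P.zero_closed by blast
  have "a \<in> P \<longrightarrow> (\<exists>p\<in>P. ring_prime p)"
  proof (rule prime_product_induct[OF P.Icarr[OF a(1)] a(2)])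
    fix u assume u: "u \<in> Units R"
    have "u \<notin> P"
    proof
      assume "u \<in> P"
      then have "inv u \<otimes> u \<in> P" using u by (intro P.I_l_closed) auto
      then show False using u P.one_imp_carrier P.I_notcarr by auto
    qed
    then show "u \<in> P \<longrightarrow> (\<exists>p\<in>P. ring_prime p)" by simp
  next
    fix p b
    assume p: "p \<in> carrier R" "ring_prime p" and b: "b \<in> carrier R"
      and IH: "b \<in> P \<longrightarrow> (\<exists>p\<in>P. ring_prime p)"
    show "p \<otimes> b \<in> P \<longrightarrow> (\<exists>p\<in>P. ring_prime p)"
      using P.I_prime[OF p(1) b] p(2) IH by blast
  qed
  then show thesis using a that by blast
qed

text \<open>
  A prime ideal strictly between \<open>0\<close> and \<open>pR\<close> would contain a prime element \<open>q = r p\<close>.  As it does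
  not contain \<open>p\<close>, primality of \<open>q\<close> gives \<open>r = s q\<close>, and cancelling \<open>q\<close> shows that \<open>p\<close> is a unit.
\<close>

lemma PIdl_prime_height_one:
  assumes p: "p \<in> carrier R" "ring_prime p"
  shows "PIdl p \<in> height_one_primes R"
proof -
  have p0: "p \<noteq> \<zero>" by (rule ring_primeE(1)[OF p])
  have prime: "primeideal (PIdl p) R"
    by (rule iffD2[OF primeideal_iff_prime p(2)]) (simp add: p p0)
  interpret P: primeideal "PIdl p" R by (rule prime)
  have pP: "p \<in> PIdl p" by (rule cgenideal_self[OF p(1)])
  have "enat n \<le> 1" if Q: "\<forall>i\<le>n. primeideal (Q i) R" "\<forall>i<n. Q i \<subset> Q (Suc i)" "Q n = PIdl p"
    for n and Q :: "nat \<Rightarrow> 'a set"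
  proof (rule ccontr)
    assume "\<not> enat n \<le> 1"
    then obtain m where n: "n = Suc (Suc m)"
      by (cases n; cases "n - 1") (auto simp: one_enat_def)
    interpret Q: primeideal "Q (Suc m)" R using Q(1) n by simp
    have "primeideal (Q m) R" and less: "Q m \<subset> Q (Suc m)" "Q (Suc m) \<subset> PIdl p"
      using Q n by auto
    then have "\<zero> \<in> Q m"
      by (simp add: primeideal_def ideal_def additive_subgroup.zero_closed)
    then have "Q (Suc m) \<noteq> {\<zero>}" using less by auto
    then obtain q where q: "q \<in> Q (Suc m)" "ring_prime q"
      using nonzero_primeideal_contains_prime[OF Q.primeideal_axioms] by blast
    have qR: "q \<in> carrier R" using q by simp
    have q0: "q \<noteq> \<zero>" by (rule ring_primeE(1)[OF qR q(2)])
    have qprime: "primeideal (PIdl q) R"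
      by (rule iffD2[OF primeideal_iff_prime q(2)]) (simp add: qR q0)
    have "q \<in> PIdl p" using q(1) less(2) by blast
    then obtain r where r: "r \<in> carrier R" "q = r \<otimes> p"
      unfolding cgenideal_def by blast
    have "r \<otimes> p \<in> PIdl q" using cgenideal_self[OF qR] unfolding r(2) .
    then consider "r \<in> PIdl q" | "p \<in> PIdl q" using primeideal.I_prime[OF qprime r(1) p(1)] by blast
    then show False
    proof cases
      case 1
      then obtain s where s: "s \<in> carrier R" "r = s \<otimes> q"
        unfolding cgenideal_def by blast
      have "q \<otimes> (s \<otimes> p) = (s \<otimes> q) \<otimes> p"
        using s(1) p(1) qR by (simp only: m_ac m_closed)
      also have "\<dots> = q \<otimes> \<one>"
        using r(2) s(2) qR by simp
      finally have "q \<otimes> (s \<otimes> p) = q \<otimes> \<one>" .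
      then have "\<one> = s \<otimes> p"
        using m_lcancel[OF q0 qR m_closed[OF s(1) p(1)] one_closed] by simp
      then have "\<one> \<in> PIdl p" using s(1) unfolding cgenideal_def by blast
      then show False using P.one_imp_carrier P.I_notcarr by blast
    next
      case 2
      then have "p \<in> Q (Suc m)"
        using Q.I_l_closed[OF q(1)] unfolding cgenideal_def by blast
      then have "PIdl p \<subseteq> Q (Suc m)"
        using Q.I_l_closed unfolding cgenideal_def by blast
      then show False using less by blast
    qed
  qed
  then have "height R (PIdl p) \<le> 1"
    unfolding height_def by (intro Sup_least) auto
  moreover have "enat 1 \<le> height R (PIdl p)"
    unfolding height_def
  proof (intro Sup_upper CollectI exI conjI)
    let ?Q = "\<lambda>i::nat. if i = 0 then {\<zero>} else PIdl p"
    show "\<forall>i\<le>1. primeideal (?Q i) R" using prime zeroprimeideal by simp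
    show "\<forall>i<1. ?Q i \<subset> ?Q (Suc i)" using pP p0 P.zero_closed by auto
    show "?Q 1 = PIdl p" by simp
  qed simp
  ultimately show ?thesis
    using prime by (simp add: height_one_primes_def one_enat_def)
qed

text \<open>Cancelling the prime factors of a nonzero element of \<open>J\<close> one by one leaves a unit in \<open>J\<close>.\<close>

lemma ideal_eq_carrier_if_prime_divisible:
  assumes J: "ideal J R" "J \<noteq> {\<zero>}"
    and divide: "\<And>p b. p \<in> carrier R \<Longrightarrow> ring_prime p \<Longrightarrow> b \<in> carrier R \<Longrightarrow> p \<otimes> b \<in> J \<Longrightarrow> b \<in> J"
  shows "J = carrier R"
proof -
  interpret J: ideal J R by (rule J)
  obtain a where a: "a \<in> J" "a \<noteq> \<zero>" using J(2) J.zero_closed by blast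
  have "a \<in> J \<longrightarrow> J = carrier R"
  proof (rule prime_product_induct[OF J.Icarr[OF a(1)] a(2)])
    fix u assume u: "u \<in> Units R"
    show "u \<in> J \<longrightarrow> J = carrier R"
    proof
      assume "u \<in> J"
      then have "inv u \<otimes> u \<in> J" using u by (intro J.I_l_closed) auto
      then show "J = carrier R" using u J.one_imp_carrier by simp
    qed
  next
    fix p b
    assume "p \<in> carrier R" "ring_prime p" "b \<in> carrier R" "b \<in> J \<longrightarrow> J = carrier R"
    then show "p \<otimes> b \<in> J \<longrightarrow> J = carrier R"
      using divide by blast
  qed
  then show ?thesis using a by simp
qed

end

section \<open>Finitely presented ideals are trivial\<close>

theorem theorem4p2:
  fixes A :: "('a, 'm) ring_scheme" and \<mm> :: "'a set"
  assumes "local_ring \<mm> A"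
    and "noetherian_ring A"
    and "factorial_domain A"
    and "\<not> field A"
  shows "\<not> (\<exists>I. ideal I (T_of A) \<and> I \<noteq> {\<zero>\<^bsub>T_of A\<^esub>} \<and> I \<noteq> carrier (T_of A) \<and>
              finitely_presented (T_of A) (ideal_module (T_of A) I))"
proof
  assume "\<exists>I. ideal I (T_of A) \<and> I \<noteq> {\<zero>\<^bsub>T_of A\<^esub>} \<and> I \<noteq> carrier (T_of A) \<and>
              finitely_presented (T_of A) (ideal_module (T_of A) I)"
  then obtain I where I: "ideal I (T_of A)" "I \<noteq> {\<zero>\<^bsub>T_of A\<^esub>}" "I \<noteq> carrier (T_of A)"
    and fp: "finitely_presented (T_of A) (ideal_module (T_of A) I)" by blast
  interpret A: factorial_domain A by fact
  note cring = A.cring_axioms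
  interpret J: ideal "fst ` I" A by (rule ideal_fst_image[OF cring I(1)])
  have "fst ` I = carrier A"
  proof (rule A.ideal_eq_carrier_if_prime_divisible[OF J.ideal_axioms])
    show "fst ` I \<noteq> {\<zero>\<^bsub>A\<^esub>}"
      using ideal_eq_zero_if_fst_zero[OF cring I(1) fp] I(2) by blast
    fix p b
    assume p: "p \<in> carrier A" "ring_prime\<^bsub>A\<^esub> p" and b: "b \<in> carrier A" "p \<otimes>\<^bsub>A\<^esub> b \<in> fst ` I"
    obtain c where c: "c \<in> fst ` I" "p \<otimes>\<^bsub>A\<^esub> b = p \<otimes>\<^bsub>A\<^esub> c"
      using fst_image_divide[OF cring I(1) fp p(1) A.PIdl_prime_height_one[OF p] b] by blast
    then have "b = c"
      using A.m_lcancel[OF A.ring_primeE(1)[OF p] p(1) b(1) J.Icarr[OF c(1)]] by simp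
    then show "b \<in> fst ` I" using c by simp
  qed
  then show False
    using ideal_eq_carrier_if_one_mem_fst[OF cring I(1)] I(3) by simp
qed

end
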